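(* Let $G$ be a block-cactus graph and let $p$ be the maximum size of a clique in $G$. (i) If no block of $G$ is an odd cycle $C_{2q+1}$ and each connected component of $G$ has at most one even cycle $C_{2q}$ as a block, then $G$ is $p$-choosable. (ii) In all other cases, $G$ is $\max(p,3)$-choosable.
   Context: All graphs are finite and simple. A graph $G=(V,E)$ is $\ell$-choosable if for every assignment of lists $L(v)$ of colors with $|L(v)|=\ell$ for all $v\in V$, there is a proper coloring $c$ of $G$ with $c(v)\in L(v)$ for all $v\in V$. A cut vertex of a connected graph is a vertex whose removal disconnects it; a block of a graph is a maximal connected subgraph without a cut vertex (of itself). A block-cactus graph is a graph each of whose blocks is either a clique (complete graph) or a cycle of length at least four; "cycle" blocks here refer to the latter kind (a triangle block counts as a clique). $C_n$ denotes the cycle on $n$ vertices. *)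

theory Defs
  imports "Graph_Theory.Graph_Theory"
begin

text \<open>
  A finite simple graph is modelled, as in \<open>Graph_Theory\<close>, by the locale predicate \<^const>\<open>graph\<close>:
  a finite, symmetric digraph without loops and parallel arcs. An edge is a pair of opposite arcs,
  so subgraphs of interest are required to be symmetric again (\<^const>\<open>graph\<close>).
\<close>

subsection \<open>Cliques and cycles\<close>

definition clique_number :: "('a,'b) pre_digraph \<Rightarrow> nat" where
  "clique_number G = Max {n. \<exists>H. subgraph H G \<and> K\<^bsub>n\<^esub> H}"

definition cycle_graph :: "nat \<Rightarrow> ('a,'b) pre_digraph \<Rightarrow> bool" where
  "cycle_graph n G \<longleftrightarrow> graph G \<and> 3 \<le> n \<and>
    (\<exists>f. bij_betw f {..<n} (verts G) \<and>
      arcs_ends G = (\<Union>i<n. {(f i, f (Suc i mod n)), (f (Suc i mod n), f i)}))"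

subsection \<open>Blocks and components\<close>

text \<open>
  The library's \<^const>\<open>connected\<close> is false for the graph without vertices. Deleting the only vertex
  of a one-vertex graph does not disconnect it, hence the nonemptiness condition.
\<close>

definition cut_vertex :: "('a,'b) pre_digraph \<Rightarrow> 'a \<Rightarrow> bool" where
  "cut_vertex G v \<longleftrightarrow> v \<in> verts G \<and>
    verts (pre_digraph.del_vert G v) \<noteq> {} \<and> \<not> connected (pre_digraph.del_vert G v)"

definition is_block :: "('a,'b) pre_digraph \<Rightarrow> ('a,'b) pre_digraph \<Rightarrow> bool" where
  "is_block G B \<longleftrightarrow>
    pre_digraph.max_subgraph G (\<lambda>H. graph H \<and> connected H \<and> \<not> (\<exists>v. cut_vertex H v)) B"

definition is_component :: "('a,'b) pre_digraph \<Rightarrow> ('a,'b) pre_digraph \<Rightarrow> bool" where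
  "is_component G C \<longleftrightarrow> pre_digraph.max_subgraph G (\<lambda>H. graph H \<and> connected H) C"

definition block_cactus :: "('a,'b) pre_digraph \<Rightarrow> bool" where
  "block_cactus G \<longleftrightarrow> graph G \<and>
    (\<forall>B. is_block G B \<longrightarrow> (\<exists>n. K\<^bsub>n\<^esub> B) \<or> (\<exists>n\<ge>4. cycle_graph n B))"

text \<open>Cycle blocks are those of length at least four; a triangle counts as a clique.\<close>

definition odd_cycle_block :: "('a,'b) pre_digraph \<Rightarrow> ('a,'b) pre_digraph \<Rightarrow> bool" where
  "odd_cycle_block G B \<longleftrightarrow> is_block G B \<and> (\<exists>q\<ge>2. cycle_graph (2 * q + 1) B)"

definition even_cycle_block :: "('a,'b) pre_digraph \<Rightarrow> ('a,'b) pre_digraph \<Rightarrow> bool" where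
  "even_cycle_block G B \<longleftrightarrow> is_block G B \<and> (\<exists>q\<ge>2. cycle_graph (2 * q) B)"

subsection \<open>List colouring\<close>

text \<open>
  The type of colours is a parameter, since a definition cannot quantify over types.
\<close>

definition choosable :: "'c itself \<Rightarrow> nat \<Rightarrow> ('a,'b) pre_digraph \<Rightarrow> bool" where
  "choosable _ l G \<longleftrightarrow>
    (\<forall>L :: 'a \<Rightarrow> 'c set. (\<forall>v\<in>verts G. finite (L v) \<and> card (L v) = l) \<longrightarrow>
      (\<exists>c. (\<forall>v\<in>verts G. c v \<in> L v) \<and> (\<forall>u v. u \<rightarrow>\<^bsub>G\<^esub> v \<longrightarrow> c u \<noteq> c v)))"

end

theory Submission
  imports Defs
begin

text \<open>
  A maximal path in a nonempty vertex set \<open>S\<close> has an end whose neighbours in \<open>S\<close> all lie on the path;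
  if there are at least two of them, they lie together with the end on a single cycle. A cycle
  with its chords has no cut vertex, so it is contained in a block, and the end has degree at most
  \<open>max (p - 1) 2\<close> in \<open>S\<close>. Hence the graph is \<open>(max p 3 - 1)\<close>-degenerate and greedy list colouring
  proves the bound \<open>max p 3\<close>.

  The only remaining case with edges is \<open>p = 2\<close>, where under the hypothesis of (i) every cycle spans an
  even cycle block and no component contains cycles on two different vertex sets. When colouring \<open>S\<close> by
  induction one may assume that \<open>S\<close> is connected with all degrees at least two. If a cycle in \<open>S\<close> did
  not exhaust \<open>S\<close>, a maximal path winding around the cycle once and then leaving it would end on a
  second cycle. So \<open>S\<close> is an even cycle, which is 2-choosable.
\<close>

subsection \<open>List colouring of a binary relation\<close>

definition list_colourable :: "('a \<Rightarrow> 'a \<Rightarrow> bool) \<Rightarrow> 'a set \<Rightarrow> ('a \<Rightarrow> 'c set) \<Rightarrow> bool" where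
  "list_colourable E S L \<longleftrightarrow>
    (\<exists>c. (\<forall>v\<in>S. c v \<in> L v) \<and> (\<forall>u\<in>S. \<forall>v\<in>S. E u v \<longrightarrow> c u \<noteq> c v))"

text \<open>Greedy step: the neighbours of \<open>v\<close> block fewer colours than
  \<open>L v\<close> offers. The strict inequality also makes \<open>L v\<close> finite, since
  infinite sets have cardinality 0.\<close>

lemma list_colourable_extend:
  assumes sym: "symp E" and irr: "irreflp E" and fin: "finite S"
    and deg: "card {u \<in> S. E v u} < card (L v)"
    and col: "list_colourable E (S - {v}) L"
  shows "list_colourable E S L"
proof -
  from col obtain c where c: "\<And>u. u \<in> S - {v} \<Longrightarrow> c u \<in> L u"
    "\<And>u w. u \<in> S - {v} \<Longrightarrow> w \<in> S - {v} \<Longrightarrow> E u w \<Longrightarrow> c u \<noteq> c w"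
    unfolding list_colourable_def by blast
  have "card (c ` {u \<in> S. E v u}) < card (L v)"
    using deg card_image_le[of "{u \<in> S. E v u}" c] fin by simp
  then have "\<not> L v \<subseteq> c ` {u \<in> S. E v u}"
    using card_mono[of "c ` {u \<in> S. E v u}" "L v"] fin by auto
  then obtain x where x: "x \<in> L v" "x \<notin> c ` {u \<in> S. E v u}" by blast
  let ?c = "c(v := x)"
  have "?c u \<in> L u" if "u \<in> S" for u using that c(1)[of u] x(1) by simp
  moreover have "?c u \<noteq> ?c w" if "u \<in> S" "w \<in> S" "E u w" for u w
  proof -
    have "u \<noteq> w" using that(3) irr by (auto simp: irreflp_def)
    then consider "u = v" | "w = v" "u \<noteq> v" | "u \<noteq> v" "w \<noteq> v" by blast
    then show ?thesis
    proof cases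
      case 1
      then show ?thesis using x(2) that \<open>u \<noteq> w\<close> by force
    next
      case 2
      moreover from this have "E v u" using that(3) sym by (auto dest: sympD)
      ultimately show ?thesis using x(2) that(1) by force
    next
      case 3
      then show ?thesis using c(2)[of u w] that by simp
    qed
  qed
  ultimately show ?thesis unfolding list_colourable_def by blast
qed

lemma list_colourable_union:
  assumes "list_colourable E A L" "list_colourable E B L"
    and "\<And>u v. u \<in> A \<Longrightarrow> v \<in> B \<Longrightarrow> \<not> E u v \<and> \<not> E v u"
  shows "list_colourable E (A \<union> B) L"
proof -
  from assms(1,2) obtain c d where
    "\<forall>v\<in>A. c v \<in> L v" "\<forall>u\<in>A. \<forall>v\<in>A. E u v \<longrightarrow> c u \<noteq> c v"
    "\<forall>v\<in>B. d v \<in> L v" "\<forall>u\<in>B. \<forall>v\<in>B. E u v \<longrightarrow> d u \<noteq> d v"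
    unfolding list_colourable_def by blast
  with assms(3) show ?thesis
    unfolding list_colourable_def by (intro exI[of _ "\<lambda>v. if v \<in> A then c v else d v"]) auto
qed

text \<open>A vertex of low degree is removed and coloured last. The degree assumption ranges over
  all nonempty \<open>T\<close>, so it passes to \<open>S - {v}\<close>.\<close>

lemma list_colourable_degenerate:
  assumes "symp E" "irreflp E" "finite S"
    and "\<And>v. v \<in> S \<Longrightarrow> card (L v) = l"
    and "\<And>T. T \<subseteq> S \<Longrightarrow> T \<noteq> {} \<Longrightarrow> \<exists>v\<in>T. card {u \<in> T. E v u} < l"
  shows "list_colourable E S L"
  using \<open>finite S\<close> assms(4,5)
proof (induction S rule: finite_psubset_induct)
  case (psubset S)
  show ?case
  proof (cases "S = {}")
    case True
    then show ?thesis by (simp add: list_colourable_def)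
  next
    case False
    then obtain v where v: "v \<in> S" "card {u \<in> S. E v u} < l"
      using psubset.prems(2)[of S] by blast
    have "list_colourable E (S - {v}) L"
    proof (rule psubset.IH)
      show "S - {v} \<subset> S" using v(1) by blast
      show "card (L u) = l" if "u \<in> S - {v}" for u using that psubset.prems(1) by blast
      show "\<exists>u\<in>T. card {w \<in> T. E u w} < l" if "T \<subseteq> S - {v}" "T \<noteq> {}" for T
        using that by (intro psubset.prems(2)) auto
    qed
    moreover have "card {u \<in> S. E v u} < card (L v)" using v psubset.prems(1)[of v] by simp
    ultimately show ?thesis
      using list_colourable_extend[OF assms(1,2) psubset.hyps] by blast
  qed
qed

text \<open>Congruence is read as divisibility of an integer difference, in which \<open>k\<close>
  cancels.\<close>

lemma mod_add_left_cancel_nat: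
  fixes i j k n :: nat
  shows "(k + i) mod n = (k + j) mod n \<longleftrightarrow> i mod n = j mod n"
proof -
  have "a mod n = b mod n \<longleftrightarrow> int n dvd int a - int b" for a b
    using mod_eq_dvd_iff[of "int a" "int n" "int b"] by (simp flip: zmod_int)
  then show ?thesis by simp
qed

text \<open>The cycle is indexed by all natural numbers with period \<open>n\<close>, so that
  wrapping around needs no separate index. If all lists agree, their two colours alternate.\<close>

lemma list_colourable_even_cycle:
  fixes g :: "nat \<Rightarrow> 'a"
  assumes n: "even n" "n > 0" and g: "\<And>i j. g i = g j \<longleftrightarrow> i mod n = j mod n"
    and E: "\<And>u v. u \<in> S \<Longrightarrow> v \<in> S \<Longrightarrow> E u v \<Longrightarrow> \<exists>i. {u, v} = {g i, g (Suc i)}"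
    and S: "S = range g"
    and L: "\<And>v. v \<in> S \<Longrightarrow> card (L v) = 2"
  shows "list_colourable E S L"
proof (cases "\<forall>i. L (g i) = L (g (Suc i))")
  case True
  have "L (g i) = L (g 0)" for i by (induction i) (use True in auto)
  moreover obtain a b where ab: "L (g 0) = {a, b}" "a \<noteq> b"
    using L[of "g 0"] S by (auto simp: card_2_iff)
  ultimately have Lg: "L v = {a, b}" if "v \<in> S" for v using that S by auto
  define c where "c v = (if \<exists>i. even i \<and> v = g i then a else b)" for v
  \<comment> \<open>Two indices of the same vertex are congruent modulo the even \<open>n\<close>,
    so the parity in \<open>c\<close> depends only on the vertex.\<close>
  have "even j" if "even i" "g i = g j" for i j
    using that g[of i j] n(1) by (metis dvd_mod_iff)
  then have cg: "c (g i) = (if even i then a else b)" for i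
    unfolding c_def by auto
  have "c u \<noteq> c v" if "u \<in> S" "v \<in> S" "E u v" for u v
  proof -
    from E[OF that] obtain i where "{u, v} = {g i, g (Suc i)}" by blast
    moreover have "c (g i) \<noteq> c (g (Suc i))" using cg[of i] cg[of "Suc i"] ab(2) by simp
    ultimately show ?thesis by (auto simp: doubleton_eq_iff)
  qed
  then show ?thesis using Lg unfolding list_colourable_def by (intro exI[of _ c]) (auto simp: c_def)
next
  case False
  then obtain k where k: "L (g k) \<noteq> L (g (Suc k))" by blast
  \<comment> \<open>Rotate so that the first vertex has a colour missing from the list of the last one; starting
    with that colour, greedy colouring along the cycle cannot fail at the end.\<close>
  define h where "h i = g (Suc k + i)" for i
  have h: "h i = h j \<longleftrightarrow> i mod n = j mod n" for i j
    unfolding h_def g by (rule mod_add_left_cancel_nat)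
  have inj_h: "inj_on h {..<n}" and inj_g: "inj_on g {..<n}"
    using h g by (auto intro!: inj_onI)
  have S_g: "S = g ` {..<n}"
  proof -
    have "g i \<in> g ` {..<n}" for i
      using g[of i "i mod n"] n(2) by (auto intro!: image_eqI[of _ _ "i mod n"])
    then show ?thesis using S by auto
  qed
  moreover have "h ` {..<n} \<subseteq> S" using S by (auto simp: h_def)
  \<comment> \<open>By counting: \<open>h\<close> takes \<open>n\<close> distinct values in
    \<open>S\<close>, which has \<open>n\<close> elements.\<close>
  ultimately have S_h: "S = h ` {..<n}"
    by (metis card_image card_subset_eq finite_imageI finite_lessThan inj_g inj_h)
  have E_h: "\<exists>i<n. {u, v} = {h i, h (Suc i)}" if uv: "u \<in> S" "v \<in> S" "E u v" for u v
  proof -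
    from E[OF uv] obtain i where i: "{u, v} = {g i, g (Suc i)}" by blast
    have "g i \<in> S" using S by simp
    then obtain j where j: "j < n" "g i = h j" using S_h by auto
    then have "i mod n = (Suc k + j) mod n" unfolding h_def g by simp
    then have "Suc i mod n = Suc (Suc k + j) mod n" by (metis mod_Suc_eq)
    then have "g (Suc i) = h (Suc j)" unfolding h_def g by simp
    with i j show ?thesis by auto
  qed
  have Lh: "card (L (h i)) = 2" for i using L[of "h i"] S by (auto simp: h_def)
  have "h (n - 1) = g k" unfolding h_def g using n(2) by simp
  moreover have "h 0 = g (Suc k)" by (simp add: h_def)
  \<comment> \<open>Of two different two-element sets neither contains the other.\<close>
  ultimately have "\<not> L (h 0) \<subseteq> L (h (n - 1))"
    using k Lh[of 0] Lh[of "n - 1"] card_subset_eq[of "L (h (n - 1))" "L (h 0)"]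
    by (metis card.infinite zero_neq_numeral)
  then obtain x where x: "x \<in> L (h 0)" "x \<notin> L (h (n - 1))" by blast
  have ex: "\<exists>z. z \<in> L (h i) \<and> z \<noteq> y" for i y
    using Lh[of i] by (auto simp: card_2_iff)
  \<comment> \<open>Each list of size 2 has a colour different from the previous choice. The
    recursion never returns to \<open>x\<close> on purpose; \<open>c\<close> reads only the values
    at indices below \<open>n\<close>.\<close>
  define d where "d = rec_nat x (\<lambda>i y. SOME z. z \<in> L (h (Suc i)) \<and> z \<noteq> y)"
  have d0: "d 0 = x" by (simp add: d_def)
  have dS: "d (Suc i) \<in> L (h (Suc i)) \<and> d (Suc i) \<noteq> d i" for i
    unfolding d_def using someI_ex[OF ex[of "Suc i" "d i"]] by (simp add: d_def)
  have dL: "d i \<in> L (h i)" for i using x(1) d0 dS by (cases i) auto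
  define c where "c = d \<circ> inv_into {..<n} h"
  have c: "c (h i) = d i" if "i < n" for i
    using inj_h that by (simp add: c_def)
  have "c (h i) \<noteq> c (h (Suc i))" if "i < n" for i
  proof (cases "Suc i < n")
    case True
    then show ?thesis using c dS[of i] by auto
  next
    case False
    \<comment> \<open>The closing edge: the colour \<open>x\<close> of \<open>h 0\<close> was chosen
      outside the list of \<open>h (n - 1)\<close>.\<close>
    then have "n = Suc i" using that by simp
    then have "h (Suc i) = h 0" by (simp add: h)
    then show ?thesis using c[of i] c[of 0] dL[of i] x(2) d0 \<open>n = Suc i\<close> by auto
  qed
  then have "c u \<noteq> c v" if "u \<in> S" "v \<in> S" "E u v" for u v
    using E_h[OF that] by (metis doubleton_eq_iff)
  then show ?thesis
    using c dL S_h unfolding list_colourable_def by (intro exI[of _ c]) auto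
qed

subsection \<open>Paths and cycles as vertex lists\<close>

definition path_in :: "('a \<Rightarrow> 'a \<Rightarrow> bool) \<Rightarrow> 'a set \<Rightarrow> 'a list \<Rightarrow> bool" where
  "path_in E S xs \<longleftrightarrow> xs \<noteq> [] \<and> distinct xs \<and> set xs \<subseteq> S \<and> successively E xs"

text \<open>The first vertex is not repeated at the end, and chords are allowed, so
  \<open>set xs\<close> may induce more than the cycle.\<close>

definition cycle_in :: "('a \<Rightarrow> 'a \<Rightarrow> bool) \<Rightarrow> 'a set \<Rightarrow> 'a list \<Rightarrow> bool" where
  "cycle_in E S xs \<longleftrightarrow> distinct xs \<and> set xs \<subseteq> S \<and> 3 \<le> length xs \<and>
    successively E xs \<and> E (last xs) (hd xs)"

lemma cycle_in_rotate: "cycle_in E S (as @ bs) \<Longrightarrow> cycle_in E S (bs @ as)"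
  by (cases "as = []"; cases "bs = []") (auto simp: cycle_in_def successively_append_iff)

lemma cycle_in_rotate_to:
  assumes "cycle_in E S xs" "c \<in> set xs"
  obtains ys where "cycle_in E S (c # ys)" "set xs = set (c # ys)"
proof -
  from assms(2) obtain as bs where "xs = as @ c # bs" by (auto dest: split_list)
  with cycle_in_rotate[of E S as "c # bs"] assms(1) that[of "bs @ as"] show thesis by auto
qed

lemma cycle_in_neighbours:
  assumes "symp E" "cycle_in E S xs" "u \<in> set xs"
  obtains a b where "a \<in> set xs" "b \<in> set xs" "a \<noteq> b" "E u a" "E u b"
proof -
  obtain ys where ys: "cycle_in E S (u # ys)" "set xs = set (u # ys)"
    using cycle_in_rotate_to[OF assms(2,3)] .
  then have "ys \<noteq> []" "E u (hd ys)" "E (last ys) u" "distinct ys" "length ys \<ge> 2"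
    by (auto simp: cycle_in_def successively_Cons split: if_splits)
  moreover from this have "hd ys \<noteq> last ys"
    by (cases ys) auto
  ultimately show thesis
    using that[of "hd ys" "last ys"] ys(2) assms(1) by (auto dest: sympD)
qed

text \<open>The path grows only at its front, so the given \<open>xs\<close> survives as its tail
  end; the length is bounded by \<open>card S\<close>.\<close>

lemma maximal_path:
  assumes sym: "symp E" and fin: "finite S" and "path_in E S xs"
  obtains zs where "path_in E S (zs @ xs)" "{u \<in> S. E (hd (zs @ xs)) u} \<subseteq> set (zs @ xs)"
  using assms(3)
proof (induction "card S - length xs" arbitrary: xs thesis rule: less_induct)
  case less
  show ?case
  proof (cases "{u \<in> S. E (hd xs) u} \<subseteq> set xs")
    case True
    then show ?thesis using less.prems(1)[of "[]"] less.prems(2) by simp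
  next
    case False
    then obtain u where u: "u \<in> S" "E (hd xs) u" "u \<notin> set xs" by auto
    then have p: "path_in E S (u # xs)"
      using less.prems(2) sym by (auto simp: path_in_def successively_Cons dest: sympD)
    then have "length (u # xs) \<le> card S"
      using fin card_mono[of S "set (u # xs)"] distinct_card[of "u # xs"] by (simp add: path_in_def)
    then have "card S - length (u # xs) < card S - length xs" by simp
    from less.hyps[OF this _ p] obtain zs where
      "path_in E S (zs @ u # xs)" "{w \<in> S. E (hd (zs @ u # xs)) w} \<subseteq> set (zs @ u # xs)" by blast
    then show ?thesis using less.prems(1)[of "zs @ [u]"] by simp
  qed
qed

text \<open>The neighbour of \<open>hd xs\<close> furthest along the path, at index
  \<open>m\<close>, closes the initial segment up to it into a cycle, and all other neighbours lie
  on that segment. Having two neighbours forces \<open>m\<close> to be at least 2, hence length at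
  least 3.\<close>

lemma cycle_through_path_end:
  assumes irr: "irreflp E" and sym: "symp E" and path: "path_in E S xs"
    and N: "{u \<in> S. E (hd xs) u} \<subseteq> set xs" and card: "2 \<le> card {u \<in> S. E (hd xs) u}"
  obtains ys where "cycle_in E S ys" "hd xs \<in> set ys" "{u \<in> S. E (hd xs) u} \<subseteq> set ys"
proof -
  let ?N = "{u \<in> S. E (hd xs) u}"
  have ne: "xs \<noteq> []" and dist: "distinct xs" and sub: "set xs \<subseteq> S" and succ: "successively E xs"
    using path by (auto simp: path_in_def)
  let ?I = "{i. i < length xs \<and> xs ! i \<in> ?N}"
  define m where "m = Max ?I"
  have "?N \<noteq> {}" using card by (metis card.empty not_numeral_le_zero)
  then have "?I \<noteq> {}" using N by (auto simp: in_set_conv_nth subset_iff)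
  then have m: "m \<in> ?I" unfolding m_def by (intro Max_in) auto
  have m_max: "i \<le> m" if "i \<in> ?I" for i using that unfolding m_def by (intro Max_ge) auto
  have sub_take: "?N \<subseteq> set (take (Suc m) xs)"
  proof
    fix u assume u: "u \<in> ?N"
    then obtain i where i: "i < length xs" "u = xs ! i" using N by (auto simp: in_set_conv_nth subset_iff)
    then have "i \<le> m" using u m_max by auto
    then show "u \<in> set (take (Suc m) xs)" using i by (auto simp: in_set_conv_nth intro!: exI[of _ i])
  qed
  have "hd xs \<notin> ?N" using irr by (auto simp: irreflp_def)
  have "m \<ge> 2"
  proof (rule ccontr)
    assume "\<not> m \<ge> 2"
    have "set (take (Suc m) xs) \<subseteq> {xs ! 0, xs ! 1}"
    proof
      fix u assume "u \<in> set (take (Suc m) xs)"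
      then obtain i where "i < Suc m" "u = xs ! i" by (auto simp: in_set_conv_nth)
      moreover from this \<open>\<not> m \<ge> 2\<close> have "i = 0 \<or> i = 1" by linarith
      ultimately show "u \<in> {xs ! 0, xs ! 1}" by blast
    qed
    then have "?N \<subseteq> {xs ! 1}" using sub_take \<open>hd xs \<notin> ?N\<close> ne by (auto simp: hd_conv_nth)
    then have "card ?N \<le> 1" using card_mono[of "{xs ! 1}" ?N] by simp
    then show False using card by simp
  qed
  have "last (take (Suc m) xs) = xs ! m" using m by (simp add: take_Suc_conv_app_nth)
  moreover have "E (xs ! m) (hd xs)" using m sym by (auto dest: sympD)
  moreover have "successively E (take (Suc m) xs)"
    using succ by (auto simp: successively_conv_nth)
  ultimately have "cycle_in E S (take (Suc m) xs)"
    using m \<open>m \<ge> 2\<close> dist sub by (auto simp: cycle_in_def dest: in_set_takeD)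
  then show thesis using that sub_take ne by (cases xs) auto
qed

text \<open>The front of the extended path is either a new vertex or \<open>hd xs\<close> itself, so
  it avoids \<open>tl xs\<close>. Choosing \<open>xs\<close> thus prescribes vertices that
  \<open>v\<close> must miss.\<close>

lemma cycle_through_end_of_extension:
  assumes "symp E" "irreflp E" "finite S" "path_in E S xs"
  obtains v where "v \<in> S" "v \<notin> set (tl xs)"
    "2 \<le> card {u \<in> S. E v u} \<longrightarrow>
      (\<exists>ys. cycle_in E S ys \<and> v \<in> set ys \<and> {u \<in> S. E v u} \<subseteq> set ys)"
proof -
  obtain zs where zs: "path_in E S (zs @ xs)" "{u \<in> S. E (hd (zs @ xs)) u} \<subseteq> set (zs @ xs)"
    using maximal_path[OF assms(1,3,4)] .
  show thesis
  proof (rule that[of "hd (zs @ xs)"])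
    show "hd (zs @ xs) \<in> S"
      using zs(1) hd_in_set[of "zs @ xs"] unfolding path_in_def by blast
    show "hd (zs @ xs) \<notin> set (tl xs)"
      using zs(1) assms(4) by (cases zs; cases xs) (auto simp: path_in_def)
    show "2 \<le> card {u \<in> S. E (hd (zs @ xs)) u} \<longrightarrow>
      (\<exists>ys. cycle_in E S ys \<and> hd (zs @ xs) \<in> set ys \<and> {u \<in> S. E (hd (zs @ xs)) u} \<subseteq> set ys)"
      using cycle_through_path_end[OF assms(2,1) zs] by blast
  qed
qed

text \<open>The path \<open>w # c # ys\<close> has the whole given cycle as its tail. The front of
  its extension therefore lies off that cycle, while it lies on the new one.\<close>

lemma second_cycle:
  assumes "symp E" "irreflp E" "finite S" and deg: "\<And>v. v \<in> S \<Longrightarrow> 2 \<le> card {u \<in> S. E v u}"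
    and xs: "cycle_in E S xs" and "c \<in> set xs" "w \<in> S - set xs" "E c w"
  obtains ys where "cycle_in E S ys" "set ys \<noteq> set xs"
proof -
  obtain ys where ys: "cycle_in E S (c # ys)" "set xs = set (c # ys)"
    using cycle_in_rotate_to[OF xs \<open>c \<in> set xs\<close>] .
  then have "path_in E S (w # c # ys)"
    using assms by (auto simp: path_in_def cycle_in_def dest: sympD)
  from cycle_through_end_of_extension[OF assms(1-3) this] obtain v zs
    where "v \<notin> set (c # ys)" "cycle_in E S zs" "v \<in> set zs"
    using deg by (metis list.sel(3))
  with that ys(2) show thesis by metis
qed

subsection \<open>Blocks and components\<close>

abbreviation (input) adj :: "('a,'b) pre_digraph \<Rightarrow> 'a \<Rightarrow> 'a \<Rightarrow> bool" where
  "adj G \<equiv> \<lambda>u v. u \<rightarrow>\<^bsub>G\<^esub> v"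

lemma (in graph) symp_adj: "symp (adj G)"
  by (auto intro!: sympI dest: graph_symmetric)

lemma (in graph) irreflp_adj: "irreflp (adj G)"
  by (auto intro!: irreflpI simp: arcs_ends_def arc_to_ends_def dest: no_loops)

lemma adj_induce_subgraph: "u \<rightarrow>\<^bsub>G \<restriction> S\<^esub> v \<longleftrightarrow> u \<in> S \<and> v \<in> S \<and> u \<rightarrow>\<^bsub>G\<^esub> v"
  by (auto simp: arcs_ends_def arc_to_ends_def)

lemma (in graph) graph_induce_subgraph:
  assumes "S \<subseteq> verts G"
  shows "graph (G \<restriction> S)"
proof -
  have ind: "induced_subgraph (G \<restriction> S) G" using assms by (rule induced_induce)
  interpret H: digraph "G \<restriction> S" using ind by (rule digraphI_induced)
  interpret H: sym_digraph "G \<restriction> S" using ind by (rule induced_graph_imp_graph)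
  show ?thesis by unfold_locales
qed

lemma del_vert_induce_subgraph: "pre_digraph.del_vert (G \<restriction> S) v = G \<restriction> (S - {v})"
  by (auto simp: pre_digraph.del_vert_def induce_subgraph_def)

text \<open>\<open>connected\<close> refers to reachability after \<open>mk_symmetric\<close>, which
  changes nothing when the arcs are already symmetric.\<close>

lemma (in graph) connected_iff_strongly_connected: "connected G \<longleftrightarrow> strongly_connected G"
  by (simp add: connected_def strongly_connected_def reachable_mk_symmetric_eq[OF sym_arcs])

lemma (in graph) connected_if_hub:
  assumes "s \<in> verts G" "\<And>v. v \<in> verts G \<Longrightarrow> s \<rightarrow>\<^sup>* v"
  shows "connected G"
  unfolding connected_iff_strongly_connected strongly_connected_def
  using assms by (metis empty_iff reachable_trans symmetric_reachable')

lemma (in graph) connected_if_spanning_path: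
  assumes "path_in (adj G) (verts G) xs" "set xs = verts G"
  shows "connected G"
proof (rule connected_if_hub)
  have "hd xs \<rightarrow>\<^sup>* v" if "path_in (adj G) (verts G) xs" "v \<in> set xs" for v
    using that
  proof (induction xs)
    case (Cons x xs)
    show ?case
    proof (cases "v = x")
      case True
      then show ?thesis using Cons.prems by (auto simp: path_in_def)
    next
      case False
      then have "xs \<noteq> []" "v \<in> set xs" using Cons.prems by auto
      then have "x \<rightarrow>\<^bsub>G\<^esub> hd xs" "hd xs \<rightarrow>\<^sup>* v"
        using Cons by (auto simp: path_in_def successively_Cons)
      then show ?thesis by (auto intro: adj_reachable_trans)
    qed
  qed simp
  then show "\<And>v. v \<in> verts G \<Longrightarrow> hd xs \<rightarrow>\<^sup>* v" using assms by blast
  show "hd xs \<in> verts G" using assms by (metis hd_in_set path_in_def)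
qed

lemma (in graph) connected_induce_path:
  assumes "path_in (adj G) (verts G) xs"
  shows "connected (G \<restriction> set xs)"
proof -
  interpret H: graph "G \<restriction> set xs"
    using assms by (intro graph_induce_subgraph) (simp add: path_in_def)
  have "successively (adj (G \<restriction> set xs)) xs \<longleftrightarrow> successively (adj G) xs"
    by (rule successively_cong) (auto simp: adj_induce_subgraph)
  then show ?thesis
    using assms by (intro H.connected_if_spanning_path[of xs]) (auto simp: path_in_def)
qed

text \<open>With the deleted vertex rotated to the front, the rest of the cycle is a path spanning
  the remaining vertices; chords only add arcs.\<close>

lemma (in graph) no_cut_vertex_induce_cycle:
  assumes "cycle_in (adj G) (verts G) xs"
  shows "connected (G \<restriction> set xs)" "\<not> (\<exists>v. cut_vertex (G \<restriction> set xs) v)"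
proof -
  show "connected (G \<restriction> set xs)"
    using assms by (intro connected_induce_path) (auto simp: cycle_in_def path_in_def)
  have "connected (G \<restriction> (set xs - {v}))" if v: "v \<in> set xs" for v
  proof -
    obtain ys where ys: "cycle_in (adj G) (verts G) (v # ys)" "set xs = set (v # ys)"
      using cycle_in_rotate_to[OF assms v] .
    then have "path_in (adj G) (verts G) ys"
      by (auto simp: cycle_in_def path_in_def successively_Cons)
    moreover have "set xs - {v} = set ys" using ys by (auto simp: cycle_in_def)
    ultimately show ?thesis using connected_induce_path by simp
  qed
  then show "\<not> (\<exists>v. cut_vertex (G \<restriction> set xs) v)"
    by (auto simp: cut_vertex_def del_vert_induce_subgraph)
qed

text \<open>Among the candidates containing \<open>H\<close>, one with the largest number of
  vertices plus arcs is taken. In an extension of it neither number can grow, so both sets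
  coincide.\<close>

lemma (in graph) extend_to_max_subgraph:
  assumes "subgraph H G" "P H"
  obtains M where "max_subgraph P M" "subgraph H M"
proof -
  let ?Q = "\<lambda>M. subgraph M G \<and> P M \<and> subgraph H M"
  let ?size = "\<lambda>M. card (verts M) + card (arcs M)"
  have "?Q H" using assms by (simp add: subgraph_def compatible_def)
  moreover have bound: "?size M \<le> ?size G" if "subgraph M G" for M
    using that by (intro add_mono card_mono) (simp_all add: subgraph_def)
  ultimately have "\<exists>M. ?Q M \<and> (\<forall>M'. ?Q M' \<longrightarrow> ?size M' \<le> ?size M)"
    by (intro ex_has_greatest_nat[of ?Q H ?size "Suc (?size G)"]) (auto simp: less_Suc_eq_le)
  then obtain M where M: "subgraph M G" "P M" "subgraph H M"
    and greatest: "\<And>M'. ?Q M' \<Longrightarrow> ?size M' \<le> ?size M" by blast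
  have "M' = M" if M': "subgraph M M'" "subgraph M' G" "P M'" for M'
  proof -
    have "subgraph H M'" using M(3) M'(1) by (rule subgraph_trans)
    with M' have le: "?size M' \<le> ?size M" by (intro greatest) simp
    have fin: "finite (verts M')" "finite (arcs M')"
      using fin_digraph_subgraph[OF M'(2)] by (auto simp: fin_digraph_def fin_digraph_axioms_def)
    have sub: "verts M \<subseteq> verts M'" "arcs M \<subseteq> arcs M'" "tail M = tail M'" "head M = head M'"
      using M'(1) by (simp_all add: subgraph_def compatible_def)
    have "card (verts M) \<le> card (verts M')" "card (arcs M) \<le> card (arcs M')"
      by (intro card_mono fin sub)+
    then have "card (verts M) = card (verts M')" "card (arcs M) = card (arcs M')"
      using le by linarith+
    then have "verts M = verts M'" "arcs M = arcs M'"
      using card_subset_eq[OF fin(1) sub(1)] card_subset_eq[OF fin(2) sub(2)] by simp_all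
    then show ?thesis using sub by simp
  qed
  then have "max_subgraph P M" using M(1,2) by (auto simp: max_subgraph_def)
  then show thesis using that M(3) by blast
qed

lemma (in graph) block_containing_cycle:
  assumes "cycle_in (adj G) (verts G) xs"
  obtains B where "is_block G B" "subgraph (G \<restriction> set xs) B"
proof -
  have "set xs \<subseteq> verts G" using assms by (simp add: cycle_in_def)
  then have "subgraph (G \<restriction> set xs) G" "graph (G \<restriction> set xs)"
    by (auto intro: subgraph_induce_subgraphI graph_induce_subgraph)
  then obtain B where "max_subgraph (\<lambda>H. graph H \<and> connected H \<and> \<not> (\<exists>v. cut_vertex H v)) B"
    "subgraph (G \<restriction> set xs) B"
    using no_cut_vertex_induce_cycle[OF assms] by (auto elim!: extend_to_max_subgraph[rotated 2])
  then show thesis using that by (simp add: is_block_def)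
qed

section \<open>Lower bounds for the clique number\<close>

lemma (in graph) clique_le_clique_number:
  assumes "subgraph H G" "K\<^bsub>n\<^esub> H"
  shows "n \<le> clique_number G"
proof -
  have "m \<le> card (verts G)" if "subgraph H' G" "K\<^bsub>m\<^esub> H'" for m H'
    using that card_mono[of "verts G" "verts H'"]
    by (auto simp: complete_digraph_def subgraph_def)
  \<comment> \<open>\<open>Max\<close> is meaningful only for a finite set; clique orders are
    bounded by the number of vertices.\<close>
  then have "finite {m. \<exists>H. subgraph H G \<and> K\<^bsub>m\<^esub> H}"
    by (auto intro: finite_subset[of _ "{..card (verts G)}"])
  then show ?thesis unfolding clique_number_def using assms by (intro Max_ge) auto
qed

lemma (in graph) clique_number_pos:
  assumes "v \<in> verts G"
  shows "1 \<le> clique_number G"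
proof (rule clique_le_clique_number)
  show "subgraph (G \<restriction> {v}) G" using assms by (intro subgraph_induce_subgraphI) auto
  have "\<not> v \<rightarrow>\<^bsub>G\<^esub> v" using irreflp_adj by (auto simp: irreflp_def)
  then have "arcs_ends (G \<restriction> {v}) = {}" using adj_induce_subgraph[of _ _ G "{v}"] by auto
  then show "K\<^bsub>1\<^esub> (G \<restriction> {v})"
    using assms by (auto simp: complete_digraph_def graph_induce_subgraph)
qed

lemma (in graph) clique_number_edge:
  assumes "u \<rightarrow>\<^bsub>G\<^esub> v"
  shows "2 \<le> clique_number G"
proof (rule clique_le_clique_number)
  have uv: "u \<in> verts G" "v \<in> verts G" using assms by (auto dest: adj_in_verts)
  then show "subgraph (G \<restriction> {u, v}) G" by (intro subgraph_induce_subgraphI) auto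
  have irr: "\<not> w \<rightarrow>\<^bsub>G\<^esub> w" for w using irreflp_adj by (auto simp: irreflp_def)
  then have "u \<noteq> v" using assms by blast
  moreover have "v \<rightarrow>\<^bsub>G\<^esub> u" using assms graph_symmetric by blast
  ultimately have "(a \<rightarrow>\<^bsub>G \<restriction> {u, v}\<^esub> b) = (a \<in> {u, v} \<and> b \<in> {u, v} \<and> a \<noteq> b)" for a b
    using assms irr by (auto simp: adj_induce_subgraph)
  then have "arcs_ends (G \<restriction> {u, v}) = {(a, b). (a, b) \<in> {u, v} \<times> {u, v} \<and> a \<noteq> b}"
    by auto
  then show "K\<^bsub>2\<^esub> (G \<restriction> {u, v})"
    using uv \<open>u \<noteq> v\<close> by (simp add: complete_digraph_def graph_induce_subgraph)
qed

section \<open>Cycle graphs: neighbours, spanning cycles, 2-choosability\<close>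

lemma cycle_graph_param:
  assumes "cycle_graph n B"
  obtains f pred where "bij_betw f {..<n} (verts B)"
    "\<forall>u v. u \<rightarrow>\<^bsub>B\<^esub> v \<longrightarrow> (\<exists>i<n. {u, v} = {f i, f (Suc i mod n)})"
    "\<forall>i<n. {u. f i \<rightarrow>\<^bsub>B\<^esub> u} \<subseteq> {f (Suc i mod n), pred i}"
proof -
  from assms obtain f where f: "bij_betw f {..<n} (verts B)" and n: "3 \<le> n"
    and ends: "arcs_ends B = (\<Union>i<n. {(f i, f (Suc i mod n)), (f (Suc i mod n), f i)})"
    unfolding cycle_graph_def by blast
  have inj: "inj_on f {..<n}" using f by (rule bij_betw_imp_inj_on)
  \<comment> \<open>The cyclic predecessor; adding \<open>n\<close> first keeps the subtraction from
    truncating at \<open>i = 0\<close>.\<close>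
  have pred: "j = (i + n - 1) mod n" if "j < n" "i = Suc j mod n" for i j
    using that n by (cases "Suc j = n") auto
  show thesis
  proof
    show "bij_betw f {..<n} (verts B)" by fact
    show "\<forall>u v. u \<rightarrow>\<^bsub>B\<^esub> v \<longrightarrow> (\<exists>i<n. {u, v} = {f i, f (Suc i mod n)})"
      unfolding ends by auto
    show "\<forall>i<n. {u. f i \<rightarrow>\<^bsub>B\<^esub> u} \<subseteq> {f (Suc i mod n), f ((i + n - 1) mod n)}"
    proof (intro allI impI subsetI)
      fix i assume i: "i < n"
      fix u assume "u \<in> {u. f i \<rightarrow>\<^bsub>B\<^esub> u}"
      then obtain j where j: "j < n"
        "f i = f j \<and> u = f (Suc j mod n) \<or> f i = f (Suc j mod n) \<and> u = f j"
        unfolding ends by auto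
      have "Suc j mod n < n" using n by simp
      then have "i = j \<and> u = f (Suc j mod n) \<or> i = Suc j mod n \<and> u = f j"
        using j i inj by (auto dest: inj_onD)
      then show "u \<in> {f (Suc i mod n), f ((i + n - 1) mod n)}" using pred[OF j(1), of i] by auto
    qed
  qed
qed

lemma cycle_graph_degree_le:
  assumes "cycle_graph n B" "v \<in> verts B"
  shows "card {u. v \<rightarrow>\<^bsub>B\<^esub> u} \<le> 2"
proof -
  obtain f pred where f: "bij_betw f {..<n} (verts B)"
    "\<forall>u v. u \<rightarrow>\<^bsub>B\<^esub> v \<longrightarrow> (\<exists>i<n. {u, v} = {f i, f (Suc i mod n)})"
    "\<forall>i<n. {u. f i \<rightarrow>\<^bsub>B\<^esub> u} \<subseteq> {f (Suc i mod n), pred i}"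
    using cycle_graph_param[OF assms(1)] .
  obtain i where "i < n" "v = f i" using f(1) assms(2) by (auto simp: bij_betw_def)
  then have "card {u. v \<rightarrow>\<^bsub>B\<^esub> u} \<le> card {f (Suc i mod n), pred i}"
    using f(3) by (intro card_mono) auto
  also have "\<dots> \<le> 2" by (simp add: card_insert_if)
  finally show ?thesis .
qed

text \<open>A vertex of \<open>xs\<close> has two distinct neighbours on \<open>xs\<close>, and a
  cycle graph offers only two candidates. So the successor lies on \<open>xs\<close> too, and going
  round reaches every vertex.\<close>

lemma cycle_in_cycle_graph_spanning:
  assumes cyc: "cycle_graph n B" and xs: "cycle_in (adj B) (verts B) xs"
  shows "set xs = verts B"
proof -
  interpret B: graph B using cyc by (simp add: cycle_graph_def)
  obtain f pred where f: "bij_betw f {..<n} (verts B)"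
    "\<forall>u v. u \<rightarrow>\<^bsub>B\<^esub> v \<longrightarrow> (\<exists>i<n. {u, v} = {f i, f (Suc i mod n)})"
    "\<forall>i<n. {u. f i \<rightarrow>\<^bsub>B\<^esub> u} \<subseteq> {f (Suc i mod n), pred i}"
    using cycle_graph_param[OF cyc] .
  have step: "f (Suc i mod n) \<in> set xs" if i: "i < n" "f i \<in> set xs" for i
  proof -
    obtain a b where "a \<in> set xs" "b \<in> set xs" "a \<noteq> b" "f i \<rightarrow>\<^bsub>B\<^esub> a" "f i \<rightarrow>\<^bsub>B\<^esub> b"
      using cycle_in_neighbours[OF B.symp_adj xs i(2)] .
    moreover from this have "{a, b} \<subseteq> {f (Suc i mod n), pred i}"
      using f(3)[rule_format, OF i(1)] by blast
    ultimately show ?thesis by (metis doubleton_eq_iff insert_subset insertE singletonD)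
  qed
  have "set xs \<subseteq> verts B" "xs \<noteq> []" using xs by (auto simp: cycle_in_def)
  then have "hd xs \<in> f ` {..<n}" using bij_betw_imp_surj_on[OF f(1)] hd_in_set by blast
  then obtain i where "i < n" "hd xs = f i" by auto
  then have i: "i < n" "f i \<in> set xs" using hd_in_set[OF \<open>xs \<noteq> []\<close>] by auto
  have iter: "f ((i + k) mod n) \<in> set xs" for k
  proof (induction k)
    case (Suc k)
    have "f (Suc ((i + k) mod n) mod n) \<in> set xs" by (rule step) (use Suc i in auto)
    then show ?case by (simp add: mod_Suc_eq)
  qed (use i in simp)
  have "f j \<in> set xs" if "j < n" for j
  proof -
    have "(i + (n - i + j)) mod n = j" using that i(1) by simp
    then show ?thesis using iter[of "n - i + j"] by metis
  qed
  then have "f ` {..<n} \<subseteq> set xs" by (simp add: image_subset_iff)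
  then have "verts B \<subseteq> set xs" using bij_betw_imp_surj_on[OF f(1)] by simp
  with \<open>set xs \<subseteq> verts B\<close> show ?thesis by blast
qed

lemma list_colourable_even_cycle_graph:
  assumes cyc: "cycle_graph n B" and n: "even n"
    and L: "\<And>v. v \<in> verts B \<Longrightarrow> card (L v) = 2"
  shows "list_colourable (adj B) (verts B) L"
proof -
  obtain f pred where f: "bij_betw f {..<n} (verts B)"
    "\<forall>u v. u \<rightarrow>\<^bsub>B\<^esub> v \<longrightarrow> (\<exists>i<n. {u, v} = {f i, f (Suc i mod n)})"
    "\<forall>i<n. {u. f i \<rightarrow>\<^bsub>B\<^esub> u} \<subseteq> {f (Suc i mod n), pred i}"
    using cycle_graph_param[OF cyc] .
  have pos: "n > 0" using cyc by (simp add: cycle_graph_def)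
  show ?thesis
  proof (rule list_colourable_even_cycle[where g = "\<lambda>i. f (i mod n)", OF n pos])
    show "f (i mod n) = f (j mod n) \<longleftrightarrow> i mod n = j mod n" for i j
      using f(1) pos by (auto simp: bij_betw_def dest: inj_onD)
    show "verts B = range (\<lambda>i. f (i mod n))"
    proof -
      have "i \<in> range (\<lambda>i. i mod n)" if "i < n" for i
        using that by (intro image_eqI[of _ _ i]) auto
      then have "range (\<lambda>i. i mod n) = {..<n}" using pos by auto
      then show ?thesis using f(1) by (metis bij_betw_imp_surj_on image_image)
    qed
    show "\<exists>i. {u, v} = {f (i mod n), f (Suc i mod n)}" if "u \<rightarrow>\<^bsub>B\<^esub> v" for u v
      using f(2) that by (metis mod_less)
  qed (rule L)
qed

section \<open>Degrees in block-cactus graphs and the bound \<open>max p 3\<close>\<close>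

lemma cycle_in_mono_subgraph:
  assumes "cycle_in (adj G) (verts G) xs" "subgraph (G \<restriction> set xs) B"
  shows "cycle_in (adj B) (verts B) xs"
proof -
  have adj: "u \<rightarrow>\<^bsub>B\<^esub> v" if "u \<in> set xs" "v \<in> set xs" "u \<rightarrow>\<^bsub>G\<^esub> v" for u v
    using that arcs_ends_mono[OF assms(2)] adj_induce_subgraph[of u v G "set xs"] by blast
  have "xs \<noteq> []" using assms(1) by (auto simp: cycle_in_def)
  then have "last xs \<rightarrow>\<^bsub>B\<^esub> hd xs" using assms(1) by (intro adj) (auto simp: cycle_in_def)
  moreover have "successively (adj B) xs"
    using assms(1) by (auto simp: cycle_in_def intro: successively_mono adj)
  moreover have "set xs \<subseteq> verts B" using assms(2) by (auto simp: subgraph_def)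
  ultimately show ?thesis using assms(1) by (simp add: cycle_in_def)
qed

text \<open>A block contains the cycle with all its chords. Degrees in it are at most
  \<open>clique_number G - 1\<close> if it is a clique and at most 2 if it is a cycle.\<close>

lemma block_cactus_cycle_degree:
  assumes "block_cactus G" "cycle_in (adj G) (verts G) xs" "v \<in> set xs"
  shows "card {u \<in> set xs. v \<rightarrow>\<^bsub>G\<^esub> u} \<le> max (clique_number G - 1) 2"
proof -
  interpret graph G using assms(1) by (simp add: block_cactus_def)
  obtain B where B: "is_block G B" "subgraph (G \<restriction> set xs) B"
    using block_containing_cycle[OF assms(2)] .
  interpret B: graph B using B(1) by (simp add: is_block_def max_subgraph_def)
  have v: "v \<in> verts B" using B(2) assms(3) by (auto simp: subgraph_def)
  have fin: "finite {u. v \<rightarrow>\<^bsub>B\<^esub> u}"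
    by (rule finite_subset[of _ "verts B"]) (auto dest: B.adj_in_verts)
  have "{u \<in> set xs. v \<rightarrow>\<^bsub>G\<^esub> u} \<subseteq> {u. v \<rightarrow>\<^bsub>B\<^esub> u}"
    using arcs_ends_mono[OF B(2)] adj_induce_subgraph[of v _ G "set xs"] assms(3) by blast
  then have le: "card {u \<in> set xs. v \<rightarrow>\<^bsub>G\<^esub> u} \<le> card {u. v \<rightarrow>\<^bsub>B\<^esub> u}" using fin by (rule card_mono[rotated])
  consider n where "K\<^bsub>n\<^esub> B" | n where "cycle_graph n B"
    using assms(1) B(1) unfolding block_cactus_def by blast
  then show ?thesis
  proof cases
    case 1
    then have "n \<le> clique_number G"
      using B(1) by (intro clique_le_clique_number) (auto simp: is_block_def max_subgraph_def)
    moreover have "{u. v \<rightarrow>\<^bsub>B\<^esub> u} = verts B - {v}" "card (verts B) = n"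
      using 1 v by (auto simp: complete_digraph_def)
    ultimately show ?thesis using le v by simp
  next
    case 2
    then show ?thesis using cycle_graph_degree_le[OF 2 v] le by simp
  qed
qed

lemma block_cactus_degenerate:
  assumes "block_cactus G" "S \<subseteq> verts G" "S \<noteq> {}"
  shows "\<exists>v\<in>S. card {u \<in> S. v \<rightarrow>\<^bsub>G\<^esub> u} < max (clique_number G) 3"
proof -
  interpret graph G using assms(1) by (simp add: block_cactus_def)
  have fin: "finite S" using assms(2) finite_verts by (rule finite_subset)
  obtain s where "s \<in> S" using assms(3) by blast
  then have "path_in (adj G) S [s]" by (simp add: path_in_def)
  then obtain v where v: "v \<in> S" and "v \<notin> set (tl [s])" and ex:
    "2 \<le> card {u \<in> S. v \<rightarrow>\<^bsub>G\<^esub> u} \<longrightarrow>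
      (\<exists>xs. cycle_in (adj G) S xs \<and> v \<in> set xs \<and> {u \<in> S. v \<rightarrow>\<^bsub>G\<^esub> u} \<subseteq> set xs)"
    by (rule cycle_through_end_of_extension[OF symp_adj irreflp_adj fin])
  have "card {u \<in> S. v \<rightarrow>\<^bsub>G\<^esub> u} < max (clique_number G) 3"
  proof (cases "2 \<le> card {u \<in> S. v \<rightarrow>\<^bsub>G\<^esub> u}")
    case True
    then obtain xs where xs: "cycle_in (adj G) S xs" "v \<in> set xs" "{u \<in> S. v \<rightarrow>\<^bsub>G\<^esub> u} \<subseteq> set xs"
      using ex by blast
    have "cycle_in (adj G) (verts G) xs" using xs(1) assms(2) by (auto simp: cycle_in_def)
    note block_cactus_cycle_degree[OF assms(1) this xs(2)]
    moreover have "{u \<in> S. v \<rightarrow>\<^bsub>G\<^esub> u} = {u \<in> set xs. v \<rightarrow>\<^bsub>G\<^esub> u}"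
      using xs(1,3) by (auto simp: cycle_in_def)
    ultimately show ?thesis by auto
  qed auto
  then show ?thesis using v by blast
qed

lemma choosable_iff_list_colourable:
  fixes G :: "('a,'b) pre_digraph"
  assumes "wf_digraph G"
  shows "choosable TYPE('c) l G \<longleftrightarrow> (\<forall>L :: 'a \<Rightarrow> 'c set.
    (\<forall>v\<in>verts G. finite (L v) \<and> card (L v) = l) \<longrightarrow> list_colourable (adj G) (verts G) L)"
proof -
  have "u \<in> verts G \<and> v \<in> verts G" if "u \<rightarrow>\<^bsub>G\<^esub> v" for u v
    using that wf_digraph.adj_in_verts[OF assms] by blast
  then have "(\<forall>u v. u \<rightarrow>\<^bsub>G\<^esub> v \<longrightarrow> c u \<noteq> c v) \<longleftrightarrow>
    (\<forall>u\<in>verts G. \<forall>v\<in>verts G. u \<rightarrow>\<^bsub>G\<^esub> v \<longrightarrow> c u \<noteq> c v)" for c :: "'a \<Rightarrow> 'c"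
    by blast
  then show ?thesis unfolding choosable_def list_colourable_def by simp
qed

lemma block_cactus_max_3_choosable:
  assumes "block_cactus G"
  shows "choosable TYPE('c) (max (clique_number G) 3) G"
proof -
  interpret graph G using assms by (simp add: block_cactus_def)
  show ?thesis
    unfolding choosable_iff_list_colourable[OF wf_digraph]
  proof (intro allI impI)
    fix L :: "'a \<Rightarrow> 'c set"
    assume L: "\<forall>v\<in>verts G. finite (L v) \<and> card (L v) = max (clique_number G) 3"
    show "list_colourable (adj G) (verts G) L"
    proof (rule list_colourable_degenerate[OF symp_adj irreflp_adj finite_verts])
      show "card (L v) = max (clique_number G) 3" if "v \<in> verts G" for v
        using L that by blast
    qed (rule block_cactus_degenerate[OF assms])
  qed
qed

section \<open>Components and the blocks inside them\<close>

text \<open>A connected subgraph meeting a reachability class stays inside it. This second claim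
  yields the maximality in the first and also locates blocks.\<close>

lemma (in graph) reachable_class_component:
  assumes "s \<in> verts G"
  shows "is_component G (G \<restriction> {v. s \<rightarrow>\<^sup>* v})"
    and "\<And>H x. \<lbrakk>graph H; connected H; subgraph H G; x \<in> verts H; s \<rightarrow>\<^sup>* x\<rbrakk>
      \<Longrightarrow> subgraph H (G \<restriction> {v. s \<rightarrow>\<^sup>* v})"
proof -
  let ?C = "G \<restriction> {v. s \<rightarrow>\<^sup>* v}"
  have sub: "{v. s \<rightarrow>\<^sup>* v} \<subseteq> verts G" by (auto dest: reachable_in_verts)
  then interpret C: graph ?C by (rule graph_induce_subgraph)
  have CG: "subgraph ?C G" using sub by (rule subgraph_induce_subgraphI)
  have "connected ?C"
  proof (rule C.connected_if_hub)
    show "s \<in> verts ?C" using assms by simp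
    show "s \<rightarrow>\<^sup>*\<^bsub>?C\<^esub> v" if "v \<in> verts ?C" for v
      using that induce_reachable_preserves_paths[of s v] by simp
  qed
  show maxi: "subgraph H ?C"
    if H: "graph H" "connected H" "subgraph H G" "x \<in> verts H" "s \<rightarrow>\<^sup>* x" for H x
  proof -
    interpret H: graph H by fact
    have "x \<rightarrow>\<^sup>*\<^bsub>H\<^esub> v" if "v \<in> verts H" for v
      using H(2,4) that unfolding H.connected_iff_strongly_connected strongly_connected_def by blast
    then have vs: "verts H \<subseteq> {v. s \<rightarrow>\<^sup>* v}"
      using reachable_mono[OF _ H(3)] reachable_trans[OF H(5)] by blast
    have comp: "tail H = tail G" "head H = head G" and "arcs H \<subseteq> arcs G"
      using H(3) by (auto simp: subgraph_def compatible_def)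
    then have "arcs H \<subseteq> arcs ?C" using vs H.wellformed by auto
    then show ?thesis
      using vs comp H.wf_digraph C.wf_digraph by (auto simp: subgraph_def compatible_def)
  qed
  have "H = ?C" if H: "subgraph ?C H" "subgraph H G" "graph H" "connected H" for H
  proof -
    have "s \<in> verts H" using H(1) assms by (auto simp: subgraph_def)
    then have "subgraph H ?C" using maxi[OF H(3,4,2)] assms by blast
    with H(1) show ?thesis
      unfolding subgraph_def compatible_def by (intro pre_digraph.equality) auto
  qed
  then show "is_component G ?C"
    using CG \<open>connected ?C\<close> C.graph_axioms unfolding is_component_def max_subgraph_def by blast
qed

text \<open>Cycles yield blocks of \<open>G\<close>, whereas the condition on even cycles speaks of
  blocks of a component. Maximality passes down because subgraphs of the component are subgraphs of
  \<open>G\<close>.\<close>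

lemma (in graph) block_in_component:
  assumes "is_block G B" "x \<in> verts B" "s \<in> verts G" "s \<rightarrow>\<^sup>* x"
  shows "is_block (G \<restriction> {v. s \<rightarrow>\<^sup>* v}) B"
proof -
  let ?C = "G \<restriction> {v. s \<rightarrow>\<^sup>* v}"
  have "subgraph B ?C"
    using assms by (intro reachable_class_component(2)[of s B x])
      (auto simp: is_block_def max_subgraph_def)
  moreover have "subgraph ?C G"
    using reachable_class_component(1)[OF assms(3)] by (simp add: is_component_def max_subgraph_def)
  ultimately show ?thesis
    using assms(1) subgraph_trans unfolding is_block_def pre_digraph.max_subgraph_def by blast
qed

text \<open>A clique block around a cycle would have at least three vertices, against
  \<open>clique_number G \<le> 2\<close>. So the block is a cycle graph, even by assumption, and
  \<open>xs\<close> spans it.\<close>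

lemma cycle_is_even_block:
  assumes "block_cactus G" "\<not> (\<exists>B. odd_cycle_block G B)" "clique_number G \<le> 2"
    and xs: "cycle_in (adj G) (verts G) xs"
  obtains B q where "is_block G B" "2 \<le> q" "cycle_graph (2 * q) B" "verts B = set xs"
    "subgraph (G \<restriction> set xs) B"
proof -
  interpret graph G using assms(1) by (simp add: block_cactus_def)
  obtain B where B: "is_block G B" "subgraph (G \<restriction> set xs) B"
    using block_containing_cycle[OF xs] .
  interpret B: graph B using B(1) by (simp add: is_block_def max_subgraph_def)
  have "\<not> K\<^bsub>n\<^esub> B" for n
  proof
    assume K: "K\<^bsub>n\<^esub> B"
    have "card (set xs) \<le> card (verts B)" using B(2) by (intro card_mono) (auto simp: subgraph_def)
    moreover have "3 \<le> card (set xs)" using xs by (simp add: cycle_in_def distinct_card)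
    ultimately have "3 \<le> n" using K by (simp add: complete_digraph_def)
    moreover have "n \<le> clique_number G"
      using B(1) K by (intro clique_le_clique_number) (auto simp: is_block_def max_subgraph_def)
    ultimately show False using assms(3) by simp
  qed
  then obtain n where n: "4 \<le> n" "cycle_graph n B"
    using assms(1) B(1) unfolding block_cactus_def by blast
  have "even n"
  proof (rule ccontr)
    assume "odd n"
    then obtain q where "n = 2 * q + 1" by (elim oddE)
    then show False using assms(2) n B(1) by (auto simp: odd_cycle_block_def)
  qed
  then obtain q where "n = 2 * q" by (elim evenE)
  moreover have "verts B = set xs"
    using cycle_in_cycle_graph_spanning[OF n(2) cycle_in_mono_subgraph[OF xs B(2)]] by simp
  ultimately show thesis using that B n by simp
qed

subsection \<open>Choosability\<close>

text \<open>The induction runs over vertex sets \<open>S\<close> with \<open>G\<close> fixed, so the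
  hypotheses on blocks need no transfer to subgraphs.\<close>

lemma list_colourable_unicyclic:
  assumes cactus: "block_cactus G" and odd: "\<not> (\<exists>B. odd_cycle_block G B)"
    and even: "\<And>C B B'. is_component G C \<Longrightarrow> even_cycle_block C B \<Longrightarrow> even_cycle_block C B' \<Longrightarrow> B = B'"
    and p: "clique_number G \<le> 2"
    and S: "S \<subseteq> verts G" and L: "\<And>v. v \<in> S \<Longrightarrow> card (L v) = 2"
  shows "list_colourable (adj G) S L"
proof -
  interpret graph G using cactus by (simp add: block_cactus_def)
  have "finite S" using S finite_verts by (rule finite_subset)
  then show ?thesis using S L
  proof (induction S rule: finite_psubset_induct)
    case (psubset S)
    have IH: "list_colourable (adj G) T L" if "T \<subset> S" for T
      using psubset.IH[OF that] psubset.prems that by blast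
    let ?low = "\<exists>v\<in>S. card {u \<in> S. v \<rightarrow>\<^bsub>G\<^esub> u} < 2"
    \<comment> \<open>No arc leaves \<open>T\<close> within \<open>S\<close>, so both parts can be
      coloured separately. The negation stands in for connectedness of \<open>S\<close>.\<close>
    let ?split = "\<exists>T. T \<subset> S \<and> T \<noteq> {} \<and> (\<forall>u\<in>T. \<forall>v\<in>S - T. \<not> u \<rightarrow>\<^bsub>G\<^esub> v)"
    consider "S = {}" | ?low | ?split | "S \<noteq> {}" "\<not> ?low" "\<not> ?split" by argo
    then show ?case
    proof cases
      case 1
      then show ?thesis by (simp add: list_colourable_def)
    next
      case 2
      then obtain v where v: "v \<in> S" "card {u \<in> S. v \<rightarrow>\<^bsub>G\<^esub> u} < 2" by blast
      then have "list_colourable (adj G) (S - {v}) L" by (intro IH) blast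
      moreover have "card {u \<in> S. v \<rightarrow>\<^bsub>G\<^esub> u} < card (L v)" using v psubset.prems(2)[of v] by simp
      ultimately show ?thesis
        using list_colourable_extend[OF symp_adj irreflp_adj \<open>finite S\<close>] by blast
    next
      case 3
      then obtain T where T: "T \<subset> S" "T \<noteq> {}" "\<forall>u\<in>T. \<forall>v\<in>S - T. \<not> u \<rightarrow>\<^bsub>G\<^esub> v" by blast
      have "list_colourable (adj G) (T \<union> (S - T)) L"
      proof (rule list_colourable_union)
        show "list_colourable (adj G) T L" "list_colourable (adj G) (S - T) L"
          using T(1,2) by (auto intro!: IH)
        show "\<not> u \<rightarrow>\<^bsub>G\<^esub> v \<and> \<not> v \<rightarrow>\<^bsub>G\<^esub> u" if "u \<in> T" "v \<in> S - T" for u v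
          using T(3) that graph_symmetric by blast
      qed
      moreover have "T \<union> (S - T) = S" using T(1) by blast
      ultimately show ?thesis by simp
    next
      case 4
      have deg: "2 \<le> card {u \<in> S. v \<rightarrow>\<^bsub>G\<^esub> u}" if "v \<in> S" for v
        using 4(2) that by (meson not_less)
      have cross: "\<exists>u\<in>T. \<exists>v\<in>S - T. u \<rightarrow>\<^bsub>G\<^esub> v" if "T \<subset> S" "T \<noteq> {}" for T
        using 4(3) that by blast
      obtain s where s: "s \<in> S" using 4(1) by blast
      then have "s \<in> verts G" using psubset.prems by blast
      \<comment> \<open>Otherwise the part of \<open>S\<close> reachable from \<open>s\<close> would
        be a proper subset that no arc leaves. Reachability in \<open>G\<close> suffices, as it
        places \<open>S\<close> in one component.\<close>
      have reach: "s \<rightarrow>\<^sup>*\<^bsub>G\<^esub> v" if "v \<in> S" for v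
      proof (rule ccontr)
        assume "\<not> s \<rightarrow>\<^sup>*\<^bsub>G\<^esub> v"
        then have "{u \<in> S. s \<rightarrow>\<^sup>*\<^bsub>G\<^esub> u} \<subset> S" "{u \<in> S. s \<rightarrow>\<^sup>*\<^bsub>G\<^esub> u} \<noteq> {}"
          using that s \<open>s \<in> verts G\<close> by auto
        from cross[OF this] show False using reachable_adj_trans by blast
      qed
      have in_G: "cycle_in (adj G) (verts G) xs" if "cycle_in (adj G) S xs" for xs
        using that psubset.prems(1) by (auto simp: cycle_in_def)
      \<comment> \<open>Both cycles span even cycle blocks of the component of \<open>s\<close>,
        which coincide by \<open>even\<close>.\<close>
      have unique: "set xs = set ys" if xs: "cycle_in (adj G) S xs" and ys: "cycle_in (adj G) S ys" for xs ys
      proof -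
        let ?C = "G \<restriction> {v. s \<rightarrow>\<^sup>*\<^bsub>G\<^esub> v}"
        have "\<exists>B. even_cycle_block ?C B \<and> verts B = set zs" if zs: "cycle_in (adj G) S zs" for zs
        proof -
          obtain B q where B: "is_block G B" "2 \<le> q" "cycle_graph (2 * q) B" "verts B = set zs"
            using cycle_is_even_block[OF cactus odd p in_G[OF zs]] by metis
          have "hd zs \<in> verts B" "hd zs \<in> S" using zs B(4) by (cases zs; auto simp: cycle_in_def)+
          then have "is_block ?C B" using B(1) \<open>s \<in> verts G\<close> reach by (intro block_in_component)
          then show ?thesis using B by (auto simp: even_cycle_block_def)
        qed
        then show ?thesis
          using xs ys even[OF reachable_class_component(1)[OF \<open>s \<in> verts G\<close>]] by metis
      qed
      have "path_in (adj G) S [s]" using s by (simp add: path_in_def)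
      then obtain v where "v \<in> S" "v \<notin> set (tl [s])" "2 \<le> card {u \<in> S. v \<rightarrow>\<^bsub>G\<^esub> u} \<longrightarrow>
        (\<exists>xs. cycle_in (adj G) S xs \<and> v \<in> set xs \<and> {u \<in> S. v \<rightarrow>\<^bsub>G\<^esub> u} \<subseteq> set xs)"
        by (rule cycle_through_end_of_extension[OF symp_adj irreflp_adj \<open>finite S\<close>])
      then obtain xs where xs: "cycle_in (adj G) S xs" using deg by blast
      have "set xs = S"
      proof (rule ccontr)
        assume "set xs \<noteq> S"
        with xs have "set xs \<subset> S" "set xs \<noteq> {}" by (auto simp: cycle_in_def)
        from cross[OF this] obtain c w where "c \<in> set xs" "w \<in> S - set xs" "c \<rightarrow>\<^bsub>G\<^esub> w" by blast
        from second_cycle[OF symp_adj irreflp_adj \<open>finite S\<close> deg xs this] show False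
          using unique[OF xs] by metis
      qed
      obtain B q where B: "cycle_graph (2 * q) B" "verts B = set xs" "subgraph (G \<restriction> set xs) B"
        using cycle_is_even_block[OF cactus odd p in_G[OF xs]] by metis
      have "list_colourable (adj B) S L"
        using list_colourable_even_cycle_graph[OF B(1), of L] B(2) \<open>set xs = S\<close> psubset.prems(2) by simp
      \<comment> \<open>\<open>B\<close> contains the subgraph induced on \<open>S\<close>, so a
        colouring proper for \<open>B\<close> is proper for \<open>G\<close> on
        \<open>S\<close>.\<close>
      moreover have "u \<rightarrow>\<^bsub>B\<^esub> v" if "u \<in> S" "v \<in> S" "u \<rightarrow>\<^bsub>G\<^esub> v" for u v
        using that arcs_ends_mono[OF B(3)] adj_induce_subgraph[of u v G S] \<open>set xs = S\<close> by blast
      ultimately show ?thesis unfolding list_colourable_def by meson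
    qed
  qed
qed

theorem proposition3p6:
  fixes G :: "('a,'b) pre_digraph" and p :: nat
  assumes "block_cactus G"
    and "p = clique_number G"
  defines "cond \<equiv> \<not> (\<exists>B. odd_cycle_block G B) \<and>
    (\<forall>C. is_component G C \<longrightarrow>
      (\<forall>B B'. even_cycle_block C B \<and> even_cycle_block C B' \<longrightarrow> B = B'))"
  shows "(cond \<longrightarrow> choosable TYPE('c) p G) \<and>
    (\<not> cond \<longrightarrow> choosable TYPE('c) (max p 3) G)"
proof -
  interpret graph G using assms(1) by (simp add: block_cactus_def)
  have max: "choosable TYPE('c) (max p 3) G"
    using block_cactus_max_3_choosable[OF assms(1)] assms(2) by simp
  have "choosable TYPE('c) p G" if cond
  proof -
    consider "p \<ge> 3" | "p = 2" | "p \<le> 1" by linarith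
    then show ?thesis
    proof cases
      case 1
      then show ?thesis using max by (simp add: max_absorb1)
    next
      case 2
      then show ?thesis
        unfolding choosable_iff_list_colourable[OF wf_digraph]
        using that assms(1,2) unfolding cond_def
        by (intro allI impI list_colourable_unicyclic) auto
    next
      case 3
      then have no_edge: "\<not> u \<rightarrow>\<^bsub>G\<^esub> v" for u v
        using clique_number_edge[of u v] assms(2) by auto
      show ?thesis
        unfolding choosable_iff_list_colourable[OF wf_digraph]
      proof (intro allI impI)
        fix L :: "'a \<Rightarrow> 'c set"
        assume L: "\<forall>v\<in>verts G. finite (L v) \<and> card (L v) = p"
        \<comment> \<open>A vertex makes \<open>p\<close> positive, so its list is nonempty; without
          edges any choice is proper. The case \<open>p = 0\<close> can only be the empty
          graph.\<close>
        have "\<exists>x. x \<in> L v" if v: "v \<in> verts G" for v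
        proof -
          have "card (L v) \<noteq> 0" using clique_number_pos[OF v] assms(2) L v by simp
          then show ?thesis by (metis card.empty ex_in_conv)
        qed
        then show "list_colourable (adj G) (verts G) L"
          unfolding list_colourable_def using no_edge by metis
      qed
    qed
  qed
  with max show ?thesis by blast
qed

end
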